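(* Let $(V,\|\cdot\|)$ be a real or complex normed vector space with dual $(V',\|\cdot\|)$, let $E\subseteq\mathbb R$ be a closed set having $0$ as an accumulation point, and let $P_\varepsilon:V\to V$ $(\varepsilon\in E)$ be linear operators with $\sup_{\varepsilon\in E}\|P_\varepsilon\|<\infty$. Assume that there are nonzero scalars $\lambda_\varepsilon$, vectors $\varphi_\varepsilon\in V$, functionals $\nu_\varepsilon\in V'$ and linear operators $Q_\varepsilon:V\to V$ $(\varepsilon\in E)$ such that (A1) $\lambda_\varepsilon^{-1}P_\varepsilon=\varphi_\varepsilon\otimes\nu_\varepsilon+Q_\varepsilon$ for all $\varepsilon\in E$; (A2) $P_\varepsilon(\varphi_\varepsilon)=\lambda_\varepsilon\varphi_\varepsilon$, $\nu_\varepsilon P_\varepsilon=\lambda_\varepsilon\nu_\varepsilon$, $Q_\varepsilon(\varphi_\varepsilon)=0$, $\nu_\varepsilon Q_\varepsilon=0$ for all $\varepsilon\in E$; (A3) $\sum_{n=0}^\infty\sup_{\varepsilon\in E}\|Q_\varepsilon^n\|<\infty$; (A4) $\nu_0(\varphi_\varepsilon)=1$ for all $\varepsilon\in E$, and $\sup_{\varepsilon\in E}\|\varphi_\varepsilon\|<\infty$; (A5) $\eta_\varepsilon:=\|\nu_0(P_0-P_\varepsilon)\|\to0$ as $\varepsilon\to0$; (A6) there is $C_3>0$ such that $\eta_\varepsilon\cdot\|(P_0-P_\varepsilon)(\varphi_0)\|\le C_3|\Delta_\varepsilon|$ for all $\varepsilon\in E$, where $\Delta_\varepsilon:=\nu_0((P_0-P_\varepsilon)(\varphi_0))$.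 Then: a) There is $\varepsilon_0>0$ such that $\lambda_\varepsilon=\lambda_0$ for every $\varepsilon\in E$ with $|\varepsilon|\le\varepsilon_0$ and $\Delta_\varepsilon=0$. b) If $\Delta_\varepsilon\ne0$ for all sufficiently small $\varepsilon\in E\setminus\{0\}$, and if for each integer $k\ge0$ the limit $$q_k:=\lim_{\varepsilon\to0}\frac{\nu_0\left((P_0-P_\varepsilon)P_\varepsilon^{k}(P_0-P_\varepsilon)(\varphi_0)\right)}{\Delta_\varepsilon}$$ exists, then $$\lim_{\varepsilon\to0}\frac{\lambda_0-\lambda_\varepsilon}{\Delta_\varepsilon}=1-\sum_{k=0}^\infty\lambda_0^{-(k+1)}q_k .$$
   Context: For $\varphi\in V$ and $\nu\in V'$, $\varphi\otimes\nu$ denotes the rank-one operator $\psi\mapsto\nu(\psi)\varphi$. For $\nu\in V'$ and a bounded operator $P$ on $V$, $\nu P$ denotes the functional $\psi\mapsto\nu(P\psi)$; thus $\eta_\varepsilon$ is the norm of the functional $\psi\mapsto\nu_0((P_0-P_\varepsilon)\psi)$. $Q_\varepsilon^0$ is the identity. Scalars $\lambda_\varepsilon$ are complex (real if $V$ is real). All limits $\varepsilon\to0$ are along $\varepsilon\in E\setminus\{0\}$. *)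

theory Defs
  imports "HOL-Analysis.Analysis"
begin

text \<open>
  A normed vector space over the scalar field \<open>'k\<close>. The types \<open>real\<close> and \<open>complex\<close> are the
  intended instances of \<open>'k\<close>; up to isometric isomorphism they are the only ones (a real normed
  field has a multiplicative norm, so Gelfand-Mazur applies). The library has no class of
  complex normed spaces, so the scalar multiplication is a parameter. Every normed space over \<open>'k\<close>
  is a real normed space by restriction of scalars; \<open>scale_of_real\<close> says that the
  class operation \<open>scaleR\<close> is this restriction. For \<open>'k = real\<close> it says \<open>scl = scaleR\<close>.
\<close>

locale normed_space_over = vector_space scl
  for scl :: "'k::{real_normed_field,banach} \<Rightarrow> 'v::real_normed_vector \<Rightarrow> 'v" +
  assumes norm_scale: "norm (scl a x) = norm a * norm x"
    and scale_of_real: "scl (of_real r) x = r *\<^sub>R x"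

definition bounded_operator ::
  "('k::{real_normed_field,banach} \<Rightarrow> 'v::real_normed_vector \<Rightarrow> 'v) \<Rightarrow> ('v \<Rightarrow> 'v) \<Rightarrow> bool" where
  "bounded_operator scl T \<longleftrightarrow> Vector_Spaces.linear scl scl T \<and> bounded_linear T"

text \<open>
  The dual norm and the operator norm are \<open>onorm\<close>: the supremum of \<open>norm (f x) / norm x\<close>
  does not depend on whether \<open>f\<close> is regarded as linear over \<open>'k\<close> or over the reals.
  For an unbounded map \<open>onorm\<close> is meaningless, so it may only be used for bounded ones.
\<close>

definition dual ::
  "('k::{real_normed_field,banach} \<Rightarrow> 'v::real_normed_vector \<Rightarrow> 'v) \<Rightarrow> ('v \<Rightarrow> 'k) set" where
  "dual scl = {\<nu>. Vector_Spaces.linear scl (*) \<nu> \<and> bounded_linear \<nu>}"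

definition rank_one ::
  "('k::{real_normed_field,banach} \<Rightarrow> 'v::real_normed_vector \<Rightarrow> 'v) \<Rightarrow> 'v \<Rightarrow> ('v \<Rightarrow> 'k) \<Rightarrow> 'v \<Rightarrow> 'v" where
  "rank_one scl \<phi> \<nu> = (\<lambda>\<psi>. scl (\<nu> \<psi>) \<phi>)"

definition pert_eta ::
  "(real \<Rightarrow> 'v::real_normed_vector \<Rightarrow> 'v) \<Rightarrow> (real \<Rightarrow> 'v \<Rightarrow> 'k::{real_normed_field,banach}) \<Rightarrow> real \<Rightarrow> real" where
  "pert_eta P \<nu> \<epsilon> = onorm (\<lambda>\<psi>. \<nu> 0 (P 0 \<psi> - P \<epsilon> \<psi>))"

definition pert_Delta ::
  "(real \<Rightarrow> 'v::real_normed_vector \<Rightarrow> 'v) \<Rightarrow> (real \<Rightarrow> 'v) \<Rightarrow> (real \<Rightarrow> 'v \<Rightarrow> 'k::{real_normed_field,banach})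
    \<Rightarrow> real \<Rightarrow> 'k" where
  "pert_Delta P \<phi> \<nu> \<epsilon> = \<nu> 0 (P 0 (\<phi> 0) - P \<epsilon> (\<phi> 0))"

text \<open>The numerator in the definition of \<open>q\<^sub>k\<close>.\<close>

definition pert_corr ::
  "(real \<Rightarrow> 'v::real_normed_vector \<Rightarrow> 'v) \<Rightarrow> (real \<Rightarrow> 'v) \<Rightarrow> (real \<Rightarrow> 'v \<Rightarrow> 'k::{real_normed_field,banach})
    \<Rightarrow> nat \<Rightarrow> real \<Rightarrow> 'k" where
  "pert_corr P \<phi> \<nu> k \<epsilon> =
     (let \<xi> = (P \<epsilon> ^^ k) (P 0 (\<phi> 0) - P \<epsilon> (\<phi> 0)) in \<nu> 0 (P 0 \<xi> - P \<epsilon> \<xi>))"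

text \<open>
  In the perturbation theorem, the operators \<open>Q \<epsilon>\<close> are only assumed to be linear; their
  boundedness, and hence the meaningfulness of \<open>onorm (Q \<epsilon> ^^ n)\<close>, follows from the decomposition
  of \<open>P \<epsilon>\<close>. Suprema and sums of norms are taken in \<open>ennreal\<close>, so that their finiteness is an
  actual assertion.
\<close>

end

theory Submission
  imports Defs
begin

text \<open>
  Fix \<open>\<epsilon>\<close> and write \<open>L x = \<nu>\<^sub>0 ((P\<^sub>0 - P\<^sub>\<epsilon>) x)\<close>, a functional of norm \<open>\<eta>\<^sub>\<epsilon>\<close>. Evaluating \<open>\<nu>\<^sub>0\<close> at
  \<open>(P\<^sub>0 - P\<^sub>\<epsilon>) \<phi>\<^sub>\<epsilon>\<close> shows that the gap \<open>\<lambda>\<^sub>0 - \<lambda>\<^sub>\<epsilon>\<close> equals \<open>L \<phi>\<^sub>\<epsilon>\<close>; in particular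
  \<open>\<lambda>\<^sub>\<epsilon> \<longlongrightarrow> \<lambda>\<^sub>0\<close>. To bring in \<open>\<Delta>\<^sub>\<epsilon> = L \<phi>\<^sub>0\<close>, compare \<open>\<phi>\<^sub>\<epsilon>\<close> with \<open>\<phi>\<^sub>0\<close> through the spectral splitting at
  \<open>\<epsilon>\<close>: write \<open>\<phi>\<^sub>0 = \<nu>\<^sub>\<epsilon>(\<phi>\<^sub>0) \<phi>\<^sub>\<epsilon> + u\<close> with \<open>\<nu>\<^sub>\<epsilon> u = 0\<close>. On the kernel of \<open>\<nu>\<^sub>\<epsilon>\<close> the operators \<open>Q\<^sub>\<epsilon>\<close> and
  \<open>\<lambda>\<^sub>\<epsilon>\<^sup>-\<^sup>1 P\<^sub>\<epsilon>\<close> agree, so \<open>u\<close> is the Neumann series \<open>\<Sum>\<^sub>k Q\<^sub>\<epsilon>\<^sup>k w\<close> of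
  \<open>w = \<phi>\<^sub>0 - \<lambda>\<^sub>\<epsilon>\<^sup>-\<^sup>1 P\<^sub>\<epsilon> \<phi>\<^sub>0 = \<lambda>\<^sub>\<epsilon>\<^sup>-\<^sup>1 ((P\<^sub>0 - P\<^sub>\<epsilon>) \<phi>\<^sub>0 - (\<lambda>\<^sub>0 - \<lambda>\<^sub>\<epsilon>) \<phi>\<^sub>0)\<close>. Applying \<open>L\<close> gives the exact formula
  (\<open>\<nu>_gap_eq\<close>)

  \<open>\<nu>\<^sub>\<epsilon>(\<phi>\<^sub>0) (\<lambda>\<^sub>0 - \<lambda>\<^sub>\<epsilon>) = \<Delta>\<^sub>\<epsilon> - \<Sum>\<^sub>k L (Q\<^sub>\<epsilon>\<^sup>k w)\<close>.

  Everything follows from it by dominated convergence of series, the summable bound on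
  \<open>\<parallel>Q\<^sub>\<epsilon>\<^sup>k\<parallel>\<close> being uniform in \<open>\<epsilon>\<close>.

  \<^item> The same Neumann series with \<open>\<nu>\<^sub>0\<close> in place of \<open>L\<close> has terms tending to 0, whence
    \<open>\<nu>\<^sub>\<epsilon>(\<phi>\<^sub>0) \<longlongrightarrow> 1\<close> (\<open>\<nu>_\<phi>0_tendsto\<close>).

  \<^item> Since \<open>\<eta>\<^sub>\<epsilon> \<parallel>(P\<^sub>0 - P\<^sub>\<epsilon>) \<phi>\<^sub>0\<parallel>\<close> is bounded by a multiple of \<open>\<bar>\<Delta>\<^sub>\<epsilon>\<bar>\<close>, the sum is at most a constant times
    \<open>\<bar>\<Delta>\<^sub>\<epsilon>\<bar> + \<eta>\<^sub>\<epsilon> \<bar>\<lambda>\<^sub>0 - \<lambda>\<^sub>\<epsilon>\<bar>\<close>. As \<open>\<eta>\<^sub>\<epsilon> \<longlongrightarrow> 0\<close>, the gap can be absorbed on the left, so that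
    \<open>\<bar>\<lambda>\<^sub>0 - \<lambda>\<^sub>\<epsilon>\<bar>\<close> is at most a constant times \<open>\<bar>\<Delta>\<^sub>\<epsilon>\<bar>\<close> for small \<open>\<epsilon>\<close> (\<open>eventually_gap_le\<close>). This contains the
    first claim.

  \<^item> After division by \<open>\<Delta>\<^sub>\<epsilon>\<close> the terms of the sum are dominated by a summable sequence, and
    the \<open>k\<close>-th one tends to \<open>\<lambda>\<^sub>0\<^sup>-\<^sup>(\<^sup>k\<^sup>+\<^sup>1\<^sup>) q\<^sub>k\<close>: the part of \<open>w\<close> along \<open>\<phi>\<^sub>0\<close> contributes the
    bounded factor \<open>(\<lambda>\<^sub>0 - \<lambda>\<^sub>\<epsilon>) / \<Delta>\<^sub>\<epsilon>\<close> times \<open>L (P\<^sub>\<epsilon>\<^sup>k \<phi>\<^sub>0)\<close>, which vanishes in the limit. This is the second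
    claim (\<open>gap_tendsto\<close>).
\<close>

section \<open>Dominated convergence for series\<close>

text \<open>
  Tannery's theorem in the form used below, where a single neighbourhood of the limit point serves
  all summands.
\<close>

lemma tendsto_suminf_dominated:
  fixes a :: "nat \<Rightarrow> 'x \<Rightarrow> 'a :: {real_normed_algebra, banach}"
  assumes limit: "\<And>k. ((\<lambda>x. a k x) \<longlongrightarrow> c k) F"
    and bound: "\<forall>\<^sub>F x in F. \<forall>k. norm (a k x) \<le> M k"
    and M: "summable M" and F: "F \<noteq> bot"
  shows "summable c" "((\<lambda>x. \<Sum>k. a k x) \<longlongrightarrow> (\<Sum>k. c k)) F"
proof -
  have "eventually (\<lambda>(k,x). norm (a k x) \<le> M k) (at_top \<times>\<^sub>F F)"
    unfolding eventually_prod_filter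
    by (rule exI[of _ "\<lambda>_. True"], rule exI[of _ "\<lambda>x. \<forall>k. norm (a k x) \<le> M k"])
       (use bound in auto)
  from tannerys_theorem[OF limit this M F]
  show "summable c" "((\<lambda>x. \<Sum>k. a k x) \<longlongrightarrow> (\<Sum>k. c k)) F"
    by (auto intro: summable_norm_cancel)
qed

section \<open>Splitting off a simple eigenvalue\<close>

lemma bounded_linear_funpow:
  fixes T :: "'v::real_normed_vector \<Rightarrow> 'v"
  assumes "bounded_linear T"
  shows "bounded_linear (T ^^ n)"
proof (induction n)
  case 0
  show ?case by (simp add: bounded_linear_ident id_def)
next
  case (Suc n)
  show ?case using bounded_linear_compose[OF assms Suc] by (simp add: o_def)
qed

text \<open>
  A single operator \<open>P\<close> with the eigenvalue \<open>l\<close>, whose rescaling by \<open>l\<close> is the sum of a projection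
  onto the eigenvector and a remainder \<open>Q\<close>.
\<close>

locale simple_eigenvalue = normed_space_over scl
  for scl :: "'k::{real_normed_field,banach} \<Rightarrow> 'v::real_normed_vector \<Rightarrow> 'v" +
  fixes P Q :: "'v \<Rightarrow> 'v" and l :: 'k and \<phi> :: 'v and \<nu> :: "'v \<Rightarrow> 'k"
  assumes P: "bounded_operator scl P"
    and l: "l \<noteq> 0"
    and \<nu>: "\<nu> \<in> dual scl"
    and Q: "Vector_Spaces.linear scl scl Q"
    and decomp: "scl (inverse l) (P x) = rank_one scl \<phi> \<nu> x + Q x"
    and P_\<phi>: "P \<phi> = scl l \<phi>"
    and \<nu>_P: "\<nu> (P x) = l * \<nu> x"
    and Q_\<phi>: "Q \<phi> = 0"
    and \<phi>: "\<phi> \<noteq> 0"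
begin

sublocale P: Vector_Spaces.linear scl scl P
  using P by (simp add: bounded_operator_def)

sublocale Q: Vector_Spaces.linear scl scl Q
  by (fact Q)

sublocale \<nu>: Vector_Spaces.linear scl "(*)" \<nu>
  using \<nu> by (simp add: dual_def)

lemma bounded_linear_P: "bounded_linear P"
  using P by (simp add: bounded_operator_def)

lemma bounded_linear_\<nu>: "bounded_linear \<nu>"
  using \<nu> by (simp add: dual_def)

text \<open>
  The decomposition solved for \<open>Q\<close>. It exhibits \<open>Q\<close>, so far merely linear, as a difference of
  bounded operators.
\<close>

lemma Q_eq: "Q x = scl (inverse l) (P x) - scl (\<nu> x) \<phi>"
  using decomp[of x] by (simp add: rank_one_def)

lemma bounded_linear_Q: "bounded_linear Q"
proof (rule bounded_linear_intro)
  fix x y :: 'v and r :: real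
  show "Q (x + y) = Q x + Q y"
    by (rule Q.add)
  show "Q (r *\<^sub>R x) = r *\<^sub>R Q x"
    by (metis Q.scale scale_of_real)
  have "norm (Q x) \<le> norm (inverse l) * norm (P x) + norm (\<nu> x) * norm \<phi>"
    unfolding Q_eq using norm_triangle_ineq4 by (metis norm_scale)
  also have "\<dots> \<le> norm (inverse l) * (onorm P * norm x) + (onorm \<nu> * norm x) * norm \<phi>"
    by (intro add_mono mult_left_mono mult_right_mono onorm bounded_linear_P bounded_linear_\<nu>) auto
  finally show "norm (Q x) \<le> norm x * (norm (inverse l) * onorm P + onorm \<nu> * norm \<phi>)"
    by (simp add: algebra_simps)
qed

lemmas bounded_linear_Q_pow = bounded_linear_funpow[OF bounded_linear_Q]

text \<open>Applying the decomposition to the eigenvector \<open>\<phi>\<close> itself fixes the normalization.\<close>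

lemma \<nu>_\<phi>: "\<nu> \<phi> = 1"
proof -
  have "scl (\<nu> \<phi>) \<phi> = scl 1 \<phi>"
    using Q_eq[of \<phi>] l by (simp add: P_\<phi> Q_\<phi>)
  thus ?thesis using \<phi> scale_cancel_right by blast
qed

text \<open>
  On the hyperplane \<open>\<nu> = 0\<close>, which both operators leave invariant, the rank-one part vanishes,
  so \<open>Q\<close> is a rescaling of \<open>P\<close> there.
\<close>

lemma Q_pow_eq_P_pow:
  assumes "\<nu> x = 0"
  shows "(Q ^^ k) x = scl (inverse l ^ k) ((P ^^ k) x)"
proof -
  have \<nu>k: "\<nu> ((P ^^ k) x) = 0" for k
    by (induction k) (simp_all add: assms \<nu>_P)
  show ?thesis
  proof (induction k)
    case (Suc k)
    have "Q ((Q ^^ k) x) = scl (inverse l ^ k) (Q ((P ^^ k) x))"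
      by (simp add: Suc Q.scale)
    also have "Q ((P ^^ k) x) = scl (inverse l) ((P ^^ Suc k) x)"
      by (simp add: Q_eq \<nu>k)
    finally show ?case by (simp add: mult.commute)
  qed simp
qed

text \<open>
  How far \<open>x\<close> is from being an eigenvector for \<open>l\<close>. The residual lies in the hyperplane \<open>\<nu> = 0\<close>
  and does not see the component of \<open>x\<close> along \<open>\<phi>\<close>.
\<close>

definition residual :: "'v \<Rightarrow> 'v" where
  "residual x = x - scl (inverse l) (P x)"

lemma \<nu>_residual: "\<nu> (residual x) = 0"
  using l by (simp add: residual_def \<nu>.diff \<nu>.scale \<nu>_P)

lemma linear_P_pow: "Vector_Spaces.linear scl scl (P ^^ k)"
proof (induction k)
  case 0
  show ?case using linear_id by (simp add: id_def)
next
  case (Suc k)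
  show ?case using Vector_Spaces.linear_compose[OF Suc P.linear_axioms] by (simp add: o_def)
qed

lemma Q_pow_residual:
  "(Q ^^ k) (residual x) =
     scl (inverse l ^ k) ((P ^^ k) x) - scl (inverse l ^ Suc k) ((P ^^ Suc k) x)"
proof -
  interpret Pk: Vector_Spaces.linear scl scl "P ^^ k" by (rule linear_P_pow)
  show ?thesis
    unfolding Q_pow_eq_P_pow[OF \<nu>_residual]
    by (simp add: residual_def Pk.diff Pk.scale scale_right_diff_distrib funpow_swap1 mult.commute)
qed

text \<open>
  The component \<open>u = x - \<nu> x \<cdot> \<phi>\<close> of \<open>x\<close> in the hyperplane \<open>\<nu> = 0\<close> satisfies
  \<open>u - Q u = residual x\<close>, because \<open>residual\<close> annihilates \<open>\<phi>\<close>. Hence \<open>u\<close> is the Neumann series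
  of \<open>Q\<close> at \<open>residual x\<close>. Its partial sums telescope to \<open>u - (Q ^^ n) u\<close>, which yields
  convergence without appeal to completeness.
\<close>

lemma neumann_series_sums:
  fixes F :: "'v \<Rightarrow> 'k"
  assumes F: "bounded_linear F" and Q_pow: "(\<lambda>n. onorm (Q ^^ n)) \<longlonglongrightarrow> 0"
  shows "(\<lambda>k. F ((Q ^^ k) (residual x))) sums F (x - scl (\<nu> x) \<phi>)"
proof -
  define u where "u = x - scl (\<nu> x) \<phi>"
  interpret F: bounded_linear F by (fact F)
  have "residual x = u - Q u"
    by (simp add: residual_def u_def Q.diff Q.scale Q_\<phi> Q_eq[of x])
  hence step: "F ((Q ^^ k) (residual x)) = F ((Q ^^ k) u) - F ((Q ^^ Suc k) u)" for k
    by (simp add: bounded_linear.linear[OF bounded_linear_Q_pow, THEN linear_diff]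
          F.diff funpow_swap1)
  have "(\<lambda>n. F ((Q ^^ n) u)) \<longlonglongrightarrow> 0"
  proof (rule Lim_null_comparison)
    show "\<forall>\<^sub>F n in sequentially. norm (F ((Q ^^ n) u)) \<le> onorm F * (onorm (Q ^^ n) * norm u)"
    proof (intro always_eventually allI)
      fix n
      have "norm (F ((Q ^^ n) u)) \<le> onorm F * norm ((Q ^^ n) u)"
        by (rule onorm[OF F])
      also have "\<dots> \<le> onorm F * (onorm (Q ^^ n) * norm u)"
        by (intro mult_left_mono onorm bounded_linear_Q_pow onorm_pos_le F)
      finally show "norm (F ((Q ^^ n) u)) \<le> onorm F * (onorm (Q ^^ n) * norm u)" .
    qed
    show "(\<lambda>n. onorm F * (onorm (Q ^^ n) * norm u)) \<longlonglongrightarrow> 0"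
      by (intro tendsto_mult_right_zero tendsto_mult_left_zero Q_pow)
  qed
  from telescope_sums'[OF this] show ?thesis
    unfolding step by (simp add: u_def)
qed

end

section \<open>Perturbation of the eigenvalue\<close>

text \<open>
  The hypotheses of the perturbation theorem with real constants in place of extended suprema:
  \<open>p\<close> and \<open>f\<close> bound the operators and the eigenvectors, \<open>b\<close> is the summable majorant of
  the norms of the powers of \<open>Q\<close>.
\<close>

locale eigenvalue_perturbation = normed_space_over scl
  for scl :: "'k::{real_normed_field,banach} \<Rightarrow> 'v::real_normed_vector \<Rightarrow> 'v" +
  fixes E :: "real set" and P Q :: "real \<Rightarrow> 'v \<Rightarrow> 'v" and lam :: "real \<Rightarrow> 'k"
    and \<phi> :: "real \<Rightarrow> 'v" and \<nu> :: "real \<Rightarrow> 'v \<Rightarrow> 'k"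
    and p f C :: real and b :: "nat \<Rightarrow> real"
  assumes zero_in_E: "0 \<in> E" and limit_point: "0 islimpt E"
    and splitting: "\<epsilon> \<in> E \<Longrightarrow> simple_eigenvalue scl (P \<epsilon>) (Q \<epsilon>) (lam \<epsilon>) (\<phi> \<epsilon>) (\<nu> \<epsilon>)"
    and P_le: "\<epsilon> \<in> E \<Longrightarrow> norm (P \<epsilon> x) \<le> p * norm x"
    and \<phi>_le: "\<epsilon> \<in> E \<Longrightarrow> norm (\<phi> \<epsilon>) \<le> f"
    and summable_b: "summable b" and b_nonneg: "b n \<ge> 0"
    and Q_pow_le: "\<epsilon> \<in> E \<Longrightarrow> onorm (Q \<epsilon> ^^ n) \<le> b n"
    and normalized: "\<epsilon> \<in> E \<Longrightarrow> \<nu> 0 (\<phi> \<epsilon>) = 1"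
    and eta_tendsto: "(pert_eta P \<nu> \<longlongrightarrow> 0) (at 0 within E)"
    and eta_le: "\<epsilon> \<in> E \<Longrightarrow>
      pert_eta P \<nu> \<epsilon> * norm (P 0 (\<phi> 0) - P \<epsilon> (\<phi> 0)) \<le> C * norm (pert_Delta P \<phi> \<nu> \<epsilon>)"
begin

abbreviation \<eta> where "\<eta> \<equiv> pert_eta P \<nu>"
abbreviation \<Delta> where "\<Delta> \<equiv> pert_Delta P \<phi> \<nu>"
abbreviation to_zero where "to_zero \<equiv> at 0 within E"

text \<open>The functional whose norm is \<open>\<eta> \<epsilon>\<close> and whose value at \<open>\<phi> 0\<close> is \<open>\<Delta> \<epsilon>\<close>.\<close>

definition L :: "real \<Rightarrow> 'v \<Rightarrow> 'k" where
  "L \<epsilon> x = \<nu> 0 (P 0 x - P \<epsilon> x)"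

text \<open>
  The unperturbed eigenvector \<open>\<phi> 0\<close> is almost an eigenvector of \<open>P \<epsilon>\<close>; \<open>w \<epsilon>\<close> is its residual there.
\<close>

definition w :: "real \<Rightarrow> 'v" where
  "w \<epsilon> = simple_eigenvalue.residual scl (P \<epsilon>) (lam \<epsilon>) (\<phi> 0)"

lemma to_zero_nontrivial: "to_zero \<noteq> bot"
  using limit_point by (simp add: trivial_limit_within)

lemma eventually_in_E: "\<forall>\<^sub>F \<epsilon> in to_zero. \<epsilon> \<in> E"
  by (auto simp: eventually_at_filter)

lemma lam_nonzero: "\<epsilon> \<in> E \<Longrightarrow> lam \<epsilon> \<noteq> 0"
  using splitting simple_eigenvalue.l by blast

lemmas at_zero = splitting[OF zero_in_E]

lemma L_bounded_linear:
  assumes "\<epsilon> \<in> E"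
  shows "bounded_linear (L \<epsilon>)"
  unfolding L_def
  by (intro bounded_linear_compose[OF simple_eigenvalue.bounded_linear_\<nu>[OF at_zero]]
        bounded_linear_sub simple_eigenvalue.bounded_linear_P[OF splitting] assms zero_in_E)

lemma \<eta>_eq: "\<eta> \<epsilon> = onorm (L \<epsilon>)"
  by (simp add: pert_eta_def L_def[abs_def])

lemma L_le: "\<epsilon> \<in> E \<Longrightarrow> norm (L \<epsilon> x) \<le> \<eta> \<epsilon> * norm x"
  unfolding \<eta>_eq by (rule onorm[OF L_bounded_linear])

lemma \<eta>_nonneg: "\<epsilon> \<in> E \<Longrightarrow> \<eta> \<epsilon> \<ge> 0"
  unfolding \<eta>_eq by (rule onorm_pos_le[OF L_bounded_linear])

lemma \<Delta>_eq: "\<Delta> \<epsilon> = L \<epsilon> (\<phi> 0)"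
  by (simp add: pert_Delta_def L_def)

lemma L_scale: "\<epsilon> \<in> E \<Longrightarrow> L \<epsilon> (scl a x) = a * L \<epsilon> x"
proof -
  assume "\<epsilon> \<in> E"
  then interpret e: simple_eigenvalue scl "P \<epsilon>" "Q \<epsilon>" "lam \<epsilon>" "\<phi> \<epsilon>" "\<nu> \<epsilon>" by (rule splitting)
  interpret z: simple_eigenvalue scl "P 0" "Q 0" "lam 0" "\<phi> 0" "\<nu> 0" by (rule at_zero)
  show ?thesis
    by (simp add: L_def e.P.scale z.P.scale z.\<nu>.scale flip: scale_right_diff_distrib)
qed

text \<open>
  Both \<open>\<nu> 0 (P 0 (\<phi> \<epsilon>)) = lam 0\<close> and \<open>\<nu> 0 (P \<epsilon> (\<phi> \<epsilon>)) = lam \<epsilon>\<close> hold, the first because \<open>\<nu> 0\<close> is a left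
  eigenvector of \<open>P 0\<close>, the second because \<open>\<phi> \<epsilon>\<close> is a right eigenvector of \<open>P \<epsilon>\<close>, both using
  \<open>\<nu> 0 (\<phi> \<epsilon>) = 1\<close>.
\<close>

lemma gap_eq: "\<epsilon> \<in> E \<Longrightarrow> lam 0 - lam \<epsilon> = L \<epsilon> (\<phi> \<epsilon>)"
proof -
  assume e: "\<epsilon> \<in> E"
  then interpret e: simple_eigenvalue scl "P \<epsilon>" "Q \<epsilon>" "lam \<epsilon>" "\<phi> \<epsilon>" "\<nu> \<epsilon>" by (rule splitting)
  interpret z: simple_eigenvalue scl "P 0" "Q 0" "lam 0" "\<phi> 0" "\<nu> 0" by (rule at_zero)
  show ?thesis
    by (simp add: L_def z.\<nu>.diff z.\<nu>_P e.P_\<phi> z.\<nu>.scale normalized[OF e])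
qed

text \<open>
  The norm of \<open>L \<epsilon>\<close> tends to 0, so \<open>L\<close> annihilates bounded families in the limit.
\<close>

lemma L_tendsto_0:
  assumes "\<And>\<epsilon>. \<epsilon> \<in> E \<Longrightarrow> norm (x \<epsilon>) \<le> K"
  shows "((\<lambda>\<epsilon>. L \<epsilon> (x \<epsilon>)) \<longlongrightarrow> 0) to_zero"
proof (rule Lim_null_comparison)
  show "\<forall>\<^sub>F \<epsilon> in to_zero. norm (L \<epsilon> (x \<epsilon>)) \<le> \<eta> \<epsilon> * K"
    using eventually_in_E
  proof eventually_elim
    case (elim \<epsilon>)
    from L_le[OF elim, of "x \<epsilon>"] mult_left_mono[OF assms[OF elim] \<eta>_nonneg[OF elim]]
    show ?case by linarith
  qed
  show "((\<lambda>\<epsilon>. \<eta> \<epsilon> * K) \<longlongrightarrow> 0) to_zero"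
    by (intro tendsto_mult_left_zero eta_tendsto)
qed

lemma lam_tendsto: "(lam \<longlongrightarrow> lam 0) to_zero"
proof -
  have "((\<lambda>\<epsilon>. lam 0 - L \<epsilon> (\<phi> \<epsilon>)) \<longlongrightarrow> lam 0 - 0) to_zero"
    by (intro tendsto_intros L_tendsto_0[OF \<phi>_le])
  moreover have "\<forall>\<^sub>F \<epsilon> in to_zero. lam 0 - L \<epsilon> (\<phi> \<epsilon>) = lam \<epsilon>"
    using eventually_in_E by eventually_elim (simp flip: gap_eq)
  ultimately show ?thesis
    by (simp add: filterlim_cong)
qed

lemma inverse_lam_tendsto: "((\<lambda>\<epsilon>. inverse (lam \<epsilon>)) \<longlongrightarrow> inverse (lam 0)) to_zero"
  by (intro tendsto_inverse lam_tendsto lam_nonzero zero_in_E)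

text \<open>
  Any number exceeding \<open>norm (inverse (lam 0))\<close> bounds \<open>inverse (lam \<epsilon>)\<close> close to 0.
\<close>

definition K :: real where "K = norm (inverse (lam 0)) + 1"

lemma K_pos: "K > 0"
  by (simp add: K_def add_nonneg_pos)

lemma eventually_inverse_lam_le: "\<forall>\<^sub>F \<epsilon> in to_zero. norm (inverse (lam \<epsilon>)) \<le> K"
  using order_tendstoD(2)[OF tendsto_norm[OF inverse_lam_tendsto], of K]
  by (auto simp: K_def elim: eventually_mono)

lemma P_pow_le: "\<epsilon> \<in> E \<Longrightarrow> norm ((P \<epsilon> ^^ k) x) \<le> \<bar>p\<bar> ^ k * norm x"
proof (induction k)
  case (Suc k)
  have "norm (P \<epsilon> ((P \<epsilon> ^^ k) x)) \<le> p * norm ((P \<epsilon> ^^ k) x)"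
    by (rule P_le[OF Suc.prems])
  also have "\<dots> \<le> \<bar>p\<bar> * (\<bar>p\<bar> ^ k * norm x)"
    by (intro mult_mono Suc) auto
  finally show ?case by (simp add: mult.assoc)
qed simp

lemma L_P_pow_tendsto_0: "((\<lambda>\<epsilon>. L \<epsilon> ((P \<epsilon> ^^ k) x)) \<longlongrightarrow> 0) to_zero"
  by (rule L_tendsto_0[of _ "\<bar>p\<bar> ^ k * norm x"]) (rule P_pow_le)

lemma neumann_series:
  assumes "\<epsilon> \<in> E" "bounded_linear (F :: 'v \<Rightarrow> 'k)"
  shows "(\<lambda>k. F ((Q \<epsilon> ^^ k) (w \<epsilon>))) sums F (\<phi> 0 - scl (\<nu> \<epsilon> (\<phi> 0)) (\<phi> \<epsilon>))"
proof -
  interpret e: simple_eigenvalue scl "P \<epsilon>" "Q \<epsilon>" "lam \<epsilon>" "\<phi> \<epsilon>" "\<nu> \<epsilon>"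
    using assms(1) by (rule splitting)
  have "(\<lambda>n. onorm (Q \<epsilon> ^^ n)) \<longlonglongrightarrow> 0"
  proof (rule tendsto_sandwich[OF _ _ tendsto_const summable_LIMSEQ_zero[OF summable_b]])
    show "\<forall>\<^sub>F n in sequentially. 0 \<le> onorm (Q \<epsilon> ^^ n)"
      by (simp add: onorm_pos_le[OF e.bounded_linear_Q_pow])
    show "\<forall>\<^sub>F n in sequentially. onorm (Q \<epsilon> ^^ n) \<le> b n"
      by (simp add: Q_pow_le[OF assms(1)])
  qed
  from e.neumann_series_sums[OF assms(2) this] show ?thesis
    by (simp add: w_def)
qed

lemma Q_pow_w_le:
  assumes "\<epsilon> \<in> E"
  shows "norm ((Q \<epsilon> ^^ k) (w \<epsilon>)) \<le> b k * norm (w \<epsilon>)"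
proof -
  interpret e: simple_eigenvalue scl "P \<epsilon>" "Q \<epsilon>" "lam \<epsilon>" "\<phi> \<epsilon>" "\<nu> \<epsilon>"
    using assms by (rule splitting)
  have "norm ((Q \<epsilon> ^^ k) (w \<epsilon>)) \<le> onorm (Q \<epsilon> ^^ k) * norm (w \<epsilon>)"
    by (rule onorm[OF e.bounded_linear_Q_pow])
  also have "\<dots> \<le> b k * norm (w \<epsilon>)"
    by (intro mult_right_mono Q_pow_le assms) auto
  finally show ?thesis .
qed

section \<open>The functionals at the unperturbed eigenvector\<close>

text \<open>
  Each application of \<open>P \<epsilon>\<close> can be replaced, inside \<open>\<nu> 0\<close>, by one of \<open>P 0\<close> at the cost of an error
  given by \<open>L \<epsilon>\<close>, and \<open>\<nu> 0\<close> is a left eigenvector of \<open>P 0\<close>.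
\<close>

lemma \<nu>0_P_pow_tendsto:
  "((\<lambda>\<epsilon>. \<nu> 0 ((P \<epsilon> ^^ k) (\<phi> 0))) \<longlongrightarrow> lam 0 ^ k) to_zero"
proof (induction k)
  case 0
  show ?case by (simp add: normalized[OF zero_in_E])
next
  case (Suc k)
  interpret z: simple_eigenvalue scl "P 0" "Q 0" "lam 0" "\<phi> 0" "\<nu> 0" by (rule at_zero)
  have "((\<lambda>\<epsilon>. lam 0 * \<nu> 0 ((P \<epsilon> ^^ k) (\<phi> 0)) - L \<epsilon> ((P \<epsilon> ^^ k) (\<phi> 0)))
          \<longlongrightarrow> lam 0 * lam 0 ^ k - 0) to_zero"
    by (intro tendsto_intros Suc L_P_pow_tendsto_0)
  thus ?case by (simp add: L_def z.\<nu>.diff z.\<nu>_P)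
qed

text \<open>
  The term is the difference of two consecutive values of \<open>\<nu> 0 ((P \<epsilon> ^^ k) (\<phi> 0)) / lam \<epsilon> ^ k\<close>,
  each of which tends to 1.
\<close>

lemma \<nu>0_Q_pow_w_tendsto_0: "((\<lambda>\<epsilon>. \<nu> 0 ((Q \<epsilon> ^^ k) (w \<epsilon>))) \<longlongrightarrow> 0) to_zero"
proof -
  interpret z: simple_eigenvalue scl "P 0" "Q 0" "lam 0" "\<phi> 0" "\<nu> 0" by (rule at_zero)
  have "((\<lambda>\<epsilon>. inverse (lam \<epsilon>) ^ k * \<nu> 0 ((P \<epsilon> ^^ k) (\<phi> 0))
            - inverse (lam \<epsilon>) ^ Suc k * \<nu> 0 ((P \<epsilon> ^^ Suc k) (\<phi> 0)))
          \<longlongrightarrow> inverse (lam 0) ^ k * lam 0 ^ k - inverse (lam 0) ^ Suc k * lam 0 ^ Suc k) to_zero"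
    by (intro tendsto_intros inverse_lam_tendsto \<nu>0_P_pow_tendsto)
  also have "inverse (lam 0) ^ k * lam 0 ^ k - inverse (lam 0) ^ Suc k * lam 0 ^ Suc k = 0"
    using lam_nonzero[OF zero_in_E] by (simp flip: power_mult_distrib power_Suc)
  finally show ?thesis
  proof (rule Lim_transform_eventually)
    show "\<forall>\<^sub>F \<epsilon> in to_zero. inverse (lam \<epsilon>) ^ k * \<nu> 0 ((P \<epsilon> ^^ k) (\<phi> 0))
            - inverse (lam \<epsilon>) ^ Suc k * \<nu> 0 ((P \<epsilon> ^^ Suc k) (\<phi> 0)) = \<nu> 0 ((Q \<epsilon> ^^ k) (w \<epsilon>))"
      using eventually_in_E
    proof eventually_elim
      case (elim \<epsilon>)
      then interpret e: simple_eigenvalue scl "P \<epsilon>" "Q \<epsilon>" "lam \<epsilon>" "\<phi> \<epsilon>" "\<nu> \<epsilon>" by (rule splitting)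
      show ?case
        unfolding w_def e.Q_pow_residual by (simp only: z.\<nu>.diff z.\<nu>.scale)
    qed
  qed
qed

text \<open>
  Applying \<open>\<nu> 0\<close> to the Neumann series writes \<open>1 - \<nu> \<epsilon> (\<phi> 0)\<close> as a series whose terms tend to 0.
  They are dominated because \<open>w \<epsilon>\<close> stays bounded.
\<close>

lemma \<nu>_\<phi>0_tendsto: "((\<lambda>\<epsilon>. \<nu> \<epsilon> (\<phi> 0)) \<longlongrightarrow> 1) to_zero"
proof -
  interpret z: simple_eigenvalue scl "P 0" "Q 0" "lam 0" "\<phi> 0" "\<nu> 0" by (rule at_zero)
  \<comment> \<open>\<open>W\<close> bounds \<open>w \<epsilon> = \<phi> 0 - scl (inverse (lam \<epsilon>)) (P \<epsilon> (\<phi> 0))\<close> by the triangle inequality.\<close>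
  define W where "W = norm (\<phi> 0) + K * (\<bar>p\<bar> * norm (\<phi> 0))"
  have "\<forall>\<^sub>F \<epsilon> in to_zero. \<forall>k. norm (\<nu> 0 ((Q \<epsilon> ^^ k) (w \<epsilon>))) \<le> onorm (\<nu> 0) * W * b k"
    using eventually_in_E eventually_inverse_lam_le
  proof eventually_elim
    case (elim \<epsilon>)
    then interpret e: simple_eigenvalue scl "P \<epsilon>" "Q \<epsilon>" "lam \<epsilon>" "\<phi> \<epsilon>" "\<nu> \<epsilon>" by (auto intro: splitting)
    have "norm (w \<epsilon>) \<le> norm (\<phi> 0) + norm (inverse (lam \<epsilon>)) * norm (P \<epsilon> (\<phi> 0))"
      unfolding w_def e.residual_def by (metis norm_triangle_ineq4 norm_scale)
    also have "\<dots> \<le> W"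
      unfolding W_def using P_pow_le[OF elim(1), of 1 "\<phi> 0"] elim(2) K_pos
      by (intro add_left_mono mult_mono) auto
    finally have W: "norm (w \<epsilon>) \<le> W" .
    show ?case
    proof
      fix k
      have "norm (\<nu> 0 ((Q \<epsilon> ^^ k) (w \<epsilon>))) \<le> onorm (\<nu> 0) * norm ((Q \<epsilon> ^^ k) (w \<epsilon>))"
        by (rule onorm[OF z.bounded_linear_\<nu>])
      also have "\<dots> \<le> onorm (\<nu> 0) * (b k * W)"
        using Q_pow_w_le[OF elim(1), of k] mult_left_mono[OF W b_nonneg[of k]]
        by (intro mult_left_mono onorm_pos_le z.bounded_linear_\<nu>) linarith
      finally show "norm (\<nu> 0 ((Q \<epsilon> ^^ k) (w \<epsilon>))) \<le> onorm (\<nu> 0) * W * b k"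
        by (simp add: mult_ac)
    qed
  qed
  from tendsto_suminf_dominated(2)[OF \<nu>0_Q_pow_w_tendsto_0 this
      summable_mult[OF summable_b] to_zero_nontrivial]
  have "((\<lambda>\<epsilon>. 1 - (\<Sum>k. \<nu> 0 ((Q \<epsilon> ^^ k) (w \<epsilon>)))) \<longlongrightarrow> 1 - 0) to_zero"
    by (intro tendsto_diff tendsto_const) simp
  moreover have "\<forall>\<^sub>F \<epsilon> in to_zero. 1 - (\<Sum>k. \<nu> 0 ((Q \<epsilon> ^^ k) (w \<epsilon>))) = \<nu> \<epsilon> (\<phi> 0)"
    using eventually_in_E
  proof eventually_elim
    case (elim \<epsilon>)
    show ?case
      using neumann_series[OF elim z.bounded_linear_\<nu>]
      by (simp add: sums_iff z.\<nu>.diff z.\<nu>.scale normalized elim zero_in_E)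
  qed
  ultimately show ?thesis
    by (simp add: filterlim_cong)
qed

section \<open>The eigenvalue gap\<close>

text \<open>
  \<open>L \<epsilon>\<close> applied to the Neumann series. This is where the gap, which is \<open>L \<epsilon> (\<phi> \<epsilon>)\<close>, meets
  \<open>\<Delta> \<epsilon> = L \<epsilon> (\<phi> 0)\<close>.
\<close>

lemma \<nu>_gap_eq:
  assumes "\<epsilon> \<in> E"
  shows "\<nu> \<epsilon> (\<phi> 0) * (lam 0 - lam \<epsilon>) = \<Delta> \<epsilon> - (\<Sum>k. L \<epsilon> ((Q \<epsilon> ^^ k) (w \<epsilon>)))"
proof -
  interpret L: bounded_linear "L \<epsilon>" using assms by (rule L_bounded_linear)
  show ?thesis
    using neumann_series[OF assms L_bounded_linear[OF assms]]
    by (simp add: sums_iff L.diff L_scale[OF assms] \<Delta>_eq gap_eq[OF assms])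
qed

text \<open>
  Replacing \<open>lam \<epsilon>\<close> by \<open>lam 0 - (lam 0 - lam \<epsilon>)\<close> splits the residual into the part governed by
  the perturbation and a multiple of \<open>\<phi> 0\<close> proportional to the gap.
\<close>

lemma w_eq:
  assumes "\<epsilon> \<in> E"
  shows "w \<epsilon> = scl (inverse (lam \<epsilon>)) ((P 0 (\<phi> 0) - P \<epsilon> (\<phi> 0)) - scl (lam 0 - lam \<epsilon>) (\<phi> 0))"
proof -
  interpret e: simple_eigenvalue scl "P \<epsilon>" "Q \<epsilon>" "lam \<epsilon>" "\<phi> \<epsilon>" "\<nu> \<epsilon>"
    using assms by (rule splitting)
  interpret z: simple_eigenvalue scl "P 0" "Q 0" "lam 0" "\<phi> 0" "\<nu> 0" by (rule at_zero)
  show ?thesis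
    using e.l by (simp add: w_def e.residual_def z.P_\<phi> scale_right_diff_distrib scale_left_diff_distrib
      right_diff_distrib)
qed

text \<open>
  The factor \<open>\<eta> \<epsilon>\<close> that \<open>L \<epsilon>\<close> provides is spent on the first part of \<open>w \<epsilon>\<close> to produce a multiple of
  \<open>\<Delta> \<epsilon>\<close>; on the second part it stays as a small factor in front of the gap.
\<close>

lemma eventually_L_Q_pow_w_le:
  "\<forall>\<^sub>F \<epsilon> in to_zero. \<forall>k. norm (L \<epsilon> ((Q \<epsilon> ^^ k) (w \<epsilon>)))
     \<le> b k * (K * (C * norm (\<Delta> \<epsilon>) + \<eta> \<epsilon> * norm (\<phi> 0) * norm (lam 0 - lam \<epsilon>)))"
  using eventually_in_E eventually_inverse_lam_le
proof eventually_elim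
  case (elim \<epsilon>)
  let ?d = "norm (P 0 (\<phi> 0) - P \<epsilon> (\<phi> 0))" and ?g = "norm (lam 0 - lam \<epsilon>)"
  have "norm (w \<epsilon>) \<le> K * (?d + ?g * norm (\<phi> 0))"
    unfolding w_eq[OF elim(1)] norm_scale
    by (intro mult_mono elim norm_triangle_le_diff) (use K_pos in \<open>auto simp: norm_scale\<close>)
  hence "\<eta> \<epsilon> * norm (w \<epsilon>) \<le> \<eta> \<epsilon> * (K * (?d + ?g * norm (\<phi> 0)))"
    by (intro mult_left_mono \<eta>_nonneg elim)
  also have "\<dots> = K * (\<eta> \<epsilon> * ?d + \<eta> \<epsilon> * norm (\<phi> 0) * ?g)"
    by (simp add: algebra_simps)
  also have "\<dots> \<le> K * (C * norm (\<Delta> \<epsilon>) + \<eta> \<epsilon> * norm (\<phi> 0) * ?g)"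
    using eta_le[OF elim(1)] K_pos by (intro mult_left_mono add_right_mono) auto
  finally have *: "\<eta> \<epsilon> * norm (w \<epsilon>) \<le> \<dots>" .
  show ?case
  proof
    fix k
    have "norm (L \<epsilon> ((Q \<epsilon> ^^ k) (w \<epsilon>))) \<le> \<eta> \<epsilon> * norm ((Q \<epsilon> ^^ k) (w \<epsilon>))"
      by (rule L_le[OF elim(1)])
    also have "\<dots> \<le> \<eta> \<epsilon> * (b k * norm (w \<epsilon>))"
      by (intro mult_left_mono Q_pow_w_le \<eta>_nonneg elim)
    also have "\<dots> \<le> b k * (K * (C * norm (\<Delta> \<epsilon>) + \<eta> \<epsilon> * norm (\<phi> 0) * ?g))"
      using mult_left_mono[OF * b_nonneg[of k]] by (simp add: mult_ac)
    finally show "norm (L \<epsilon> ((Q \<epsilon> ^^ k) (w \<epsilon>)))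
       \<le> b k * (K * (C * norm (\<Delta> \<epsilon>) + \<eta> \<epsilon> * norm (\<phi> 0) * ?g))" .
  qed
qed

text \<open>
  The gap appears on both sides of \<open>\<nu>_gap_eq\<close>: on the left with the factor \<open>\<nu> \<epsilon> (\<phi> 0)\<close>, which is
  eventually at least 1/2 in norm, and in the bound for the sum with a factor that is eventually
  below 1/4. Absorbing the latter leaves 1/4 of the gap, which accounts for the constant 4.
\<close>

lemma eventually_gap_le:
  "\<forall>\<^sub>F \<epsilon> in to_zero. norm (lam 0 - lam \<epsilon>) \<le> 4 * (1 + suminf b * K * C) * norm (\<Delta> \<epsilon>)"
proof -
  have "((\<lambda>\<epsilon>. suminf b * K * (\<eta> \<epsilon> * norm (\<phi> 0))) \<longlongrightarrow> 0) to_zero"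
    by (intro tendsto_mult_right_zero tendsto_mult_left_zero eta_tendsto)
  hence small: "\<forall>\<^sub>F \<epsilon> in to_zero. suminf b * K * (\<eta> \<epsilon> * norm (\<phi> 0)) < 1 / 4"
    by (rule order_tendstoD) simp
  have large: "\<forall>\<^sub>F \<epsilon> in to_zero. norm (\<nu> \<epsilon> (\<phi> 0)) > 1 / 2"
    using tendsto_norm[OF \<nu>_\<phi>0_tendsto] by (rule order_tendstoD) simp
  show ?thesis
    using eventually_in_E eventually_L_Q_pow_w_le small large
  proof eventually_elim
    case (elim \<epsilon>)
    define g where "g = norm (lam 0 - lam \<epsilon>)"
    define h where "h = \<eta> \<epsilon> * norm (\<phi> 0)"
    define c where "c = K * (C * norm (\<Delta> \<epsilon>) + h * g)"
    have "norm (\<Sum>k. L \<epsilon> ((Q \<epsilon> ^^ k) (w \<epsilon>))) \<le> (\<Sum>k. b k * c)"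
      using elim(2) unfolding c_def h_def g_def
      by (intro norm_suminf_le summable_mult2 summable_b) blast
    also have "\<dots> = suminf b * c"
      by (rule suminf_mult2[OF summable_b, symmetric])
    also have "\<dots> = suminf b * K * C * norm (\<Delta> \<epsilon>) + (suminf b * K * h) * g"
      by (simp add: c_def algebra_simps)
    also have "\<dots> \<le> suminf b * K * C * norm (\<Delta> \<epsilon>) + 1 / 4 * g"
      using elim(3) by (intro add_left_mono mult_right_mono) (auto simp: g_def h_def)
    finally have "norm (\<nu> \<epsilon> (\<phi> 0) * (lam 0 - lam \<epsilon>))
        \<le> norm (\<Delta> \<epsilon>) + (suminf b * K * C * norm (\<Delta> \<epsilon>) + 1 / 4 * g)"
      unfolding \<nu>_gap_eq[OF elim(1)] by (intro norm_triangle_le_diff add_left_mono)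
    moreover have "1 / 2 * g \<le> norm (\<nu> \<epsilon> (\<phi> 0) * (lam 0 - lam \<epsilon>))"
      unfolding norm_mult using elim(4) by (intro mult_mono) (auto simp: g_def)
    ultimately show ?case
      by (simp add: g_def algebra_simps)
  qed
qed

lemma gap_eq_0: "\<exists>\<epsilon>\<^sub>0>0. \<forall>\<epsilon>\<in>E. \<bar>\<epsilon>\<bar> \<le> \<epsilon>\<^sub>0 \<longrightarrow> \<Delta> \<epsilon> = 0 \<longrightarrow> lam \<epsilon> = lam 0"
proof -
  from eventually_gap_le obtain d where d: "d > 0"
    "\<And>\<epsilon>. \<epsilon> \<in> E \<Longrightarrow> \<epsilon> \<noteq> 0 \<Longrightarrow> \<bar>\<epsilon>\<bar> < d \<Longrightarrow>
       norm (lam 0 - lam \<epsilon>) \<le> 4 * (1 + suminf b * K * C) * norm (\<Delta> \<epsilon>)"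
    unfolding eventually_at by (auto simp: dist_real_def)
  have "lam \<epsilon> = lam 0" if "\<epsilon> \<in> E" "\<bar>\<epsilon>\<bar> \<le> d / 2" "\<Delta> \<epsilon> = 0" for \<epsilon>
    \<comment> \<open>The punctured neighbourhood says nothing about \<open>\<epsilon> = 0\<close>, where the claim is trivial.\<close>
    using d(1) d(2)[of \<epsilon>] that by (cases "\<epsilon> = 0") auto
  thus ?thesis using d(1) by (intro exI[of _ "d / 2"]) auto
qed

text \<open>
  The shape of the terms from which the limits \<open>q k\<close> can be read off.
\<close>

lemma L_Q_pow_w_eq:
  assumes "\<epsilon> \<in> E"
  shows "L \<epsilon> ((Q \<epsilon> ^^ k) (w \<epsilon>)) = inverse (lam \<epsilon>) ^ (k + 1) *
    (pert_corr P \<phi> \<nu> k \<epsilon> - (lam 0 - lam \<epsilon>) * L \<epsilon> ((P \<epsilon> ^^ k) (\<phi> 0)))"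
proof -
  interpret e: simple_eigenvalue scl "P \<epsilon>" "Q \<epsilon>" "lam \<epsilon>" "\<phi> \<epsilon>" "\<nu> \<epsilon>"
    using assms by (rule splitting)
  interpret L: bounded_linear "L \<epsilon>" using assms by (rule L_bounded_linear)
  interpret Pk: Vector_Spaces.linear scl scl "P \<epsilon> ^^ k" by (rule e.linear_P_pow)
  have "\<nu> \<epsilon> (w \<epsilon>) = 0"
    unfolding w_def by (rule e.\<nu>_residual)
  from e.Q_pow_eq_P_pow[OF this] show ?thesis
    by (simp add: w_eq[OF assms] Pk.scale Pk.diff L_scale[OF assms] L.diff pert_corr_def Let_def
      flip: L_def)
qed

lemma gap_tendsto:
  assumes \<Delta>: "\<forall>\<^sub>F \<epsilon> in to_zero. \<Delta> \<epsilon> \<noteq> 0"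
    and q: "\<And>k. ((\<lambda>\<epsilon>. pert_corr P \<phi> \<nu> k \<epsilon> / \<Delta> \<epsilon>) \<longlongrightarrow> q k) to_zero"
  shows "summable (\<lambda>k. inverse (lam 0) ^ (k + 1) * q k)"
    and "((\<lambda>\<epsilon>. (lam 0 - lam \<epsilon>) / \<Delta> \<epsilon>)
           \<longlongrightarrow> 1 - (\<Sum>k. inverse (lam 0) ^ (k + 1) * q k)) to_zero"
proof -
  define G where "G = 4 * (1 + suminf b * K * C)"
  have \<eta>_le_1: "\<forall>\<^sub>F \<epsilon> in to_zero. \<eta> \<epsilon> < 1"
    using eta_tendsto by (rule order_tendstoD) simp
  define M where "M = K * (C + norm (\<phi> 0) * G)"
  have bound: "\<forall>\<^sub>F \<epsilon> in to_zero. \<forall>k. norm (L \<epsilon> ((Q \<epsilon> ^^ k) (w \<epsilon>)) / \<Delta> \<epsilon>) \<le> b k * M"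
    using eventually_in_E eventually_L_Q_pow_w_le eventually_gap_le \<eta>_le_1 \<Delta>
  proof eventually_elim
    case (elim \<epsilon>)
    have "\<eta> \<epsilon> * norm (\<phi> 0) * norm (lam 0 - lam \<epsilon>) \<le> 1 * norm (\<phi> 0) * (G * norm (\<Delta> \<epsilon>))"
      using elim \<eta>_nonneg[OF elim(1)] by (intro mult_mono) (auto simp: G_def)
    hence *: "K * (C * norm (\<Delta> \<epsilon>) + \<eta> \<epsilon> * norm (\<phi> 0) * norm (lam 0 - lam \<epsilon>))
      \<le> K * (C * norm (\<Delta> \<epsilon>) + norm (\<phi> 0) * (G * norm (\<Delta> \<epsilon>)))"
      using K_pos by (intro mult_left_mono) auto
    show ?case
    proof
      fix k
      have "norm (L \<epsilon> ((Q \<epsilon> ^^ k) (w \<epsilon>))) \<le> b k * M * norm (\<Delta> \<epsilon>)"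
        using elim(2)[rule_format, of k] mult_left_mono[OF * b_nonneg[of k]]
        by (simp add: M_def algebra_simps)
      thus "norm (L \<epsilon> ((Q \<epsilon> ^^ k) (w \<epsilon>)) / \<Delta> \<epsilon>) \<le> b k * M"
        using elim(5) by (simp add: norm_divide divide_le_eq)
    qed
  qed
  have limit: "((\<lambda>\<epsilon>. L \<epsilon> ((Q \<epsilon> ^^ k) (w \<epsilon>)) / \<Delta> \<epsilon>)
      \<longlongrightarrow> inverse (lam 0) ^ (k + 1) * q k) to_zero" for k
  proof -
    \<comment> \<open>The quotient whose limit is sought enters here; it is enough that it is bounded.\<close>
    have "((\<lambda>\<epsilon>. (lam 0 - lam \<epsilon>) / \<Delta> \<epsilon> * L \<epsilon> ((P \<epsilon> ^^ k) (\<phi> 0))) \<longlongrightarrow> 0) to_zero"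
    proof (rule Lim_null_comparison)
      show "\<forall>\<^sub>F \<epsilon> in to_zero. norm ((lam 0 - lam \<epsilon>) / \<Delta> \<epsilon> * L \<epsilon> ((P \<epsilon> ^^ k) (\<phi> 0)))
              \<le> G * norm (L \<epsilon> ((P \<epsilon> ^^ k) (\<phi> 0)))"
        using eventually_gap_le \<Delta>
      proof eventually_elim
        case (elim \<epsilon>)
        hence "norm ((lam 0 - lam \<epsilon>) / \<Delta> \<epsilon>) \<le> G"
          unfolding G_def norm_divide by (subst pos_divide_le_eq) auto
        thus ?case unfolding norm_mult by (rule mult_right_mono) simp
      qed
      show "((\<lambda>\<epsilon>. G * norm (L \<epsilon> ((P \<epsilon> ^^ k) (\<phi> 0)))) \<longlongrightarrow> 0) to_zero"
        by (intro tendsto_mult_right_zero tendsto_norm_zero L_P_pow_tendsto_0)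
    qed
    hence "((\<lambda>\<epsilon>. inverse (lam \<epsilon>) ^ (k + 1) * (pert_corr P \<phi> \<nu> k \<epsilon> / \<Delta> \<epsilon>
              - (lam 0 - lam \<epsilon>) / \<Delta> \<epsilon> * L \<epsilon> ((P \<epsilon> ^^ k) (\<phi> 0))))
            \<longlongrightarrow> inverse (lam 0) ^ (k + 1) * (q k - 0)) to_zero"
      by (intro tendsto_mult tendsto_power inverse_lam_tendsto tendsto_diff q)
    moreover have "\<forall>\<^sub>F \<epsilon> in to_zero. inverse (lam \<epsilon>) ^ (k + 1) * (pert_corr P \<phi> \<nu> k \<epsilon> / \<Delta> \<epsilon>
              - (lam 0 - lam \<epsilon>) / \<Delta> \<epsilon> * L \<epsilon> ((P \<epsilon> ^^ k) (\<phi> 0)))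
            = L \<epsilon> ((Q \<epsilon> ^^ k) (w \<epsilon>)) / \<Delta> \<epsilon>"
      using eventually_in_E
      by eventually_elim (simp only: L_Q_pow_w_eq times_divide_eq_right times_divide_eq_left
          flip: diff_divide_distrib)
    ultimately show ?thesis
      by (simp add: filterlim_cong)
  qed
  note dom = tendsto_suminf_dominated[OF limit bound summable_mult2[OF summable_b] to_zero_nontrivial]
  show "summable (\<lambda>k. inverse (lam 0) ^ (k + 1) * q k)"
    by (rule dom(1))
  \<comment> \<open>Solving \<open>\<nu>_gap_eq\<close> for the quotient of gap and \<open>\<Delta> \<epsilon>\<close>.\<close>
  have "((\<lambda>\<epsilon>. (1 - (\<Sum>k. L \<epsilon> ((Q \<epsilon> ^^ k) (w \<epsilon>)) / \<Delta> \<epsilon>)) / \<nu> \<epsilon> (\<phi> 0))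
          \<longlongrightarrow> (1 - (\<Sum>k. inverse (lam 0) ^ (k + 1) * q k)) / 1) to_zero"
    by (intro tendsto_divide tendsto_diff tendsto_const dom(2) \<nu>_\<phi>0_tendsto) simp
  moreover have "\<forall>\<^sub>F \<epsilon> in to_zero. \<nu> \<epsilon> (\<phi> 0) \<noteq> 0"
    using \<nu>_\<phi>0_tendsto by (rule tendsto_imp_eventually_ne) simp
  with eventually_in_E \<Delta> have "\<forall>\<^sub>F \<epsilon> in to_zero.
      (1 - (\<Sum>k. L \<epsilon> ((Q \<epsilon> ^^ k) (w \<epsilon>)) / \<Delta> \<epsilon>)) / \<nu> \<epsilon> (\<phi> 0) = (lam 0 - lam \<epsilon>) / \<Delta> \<epsilon>"
  proof eventually_elim
    case (elim \<epsilon>)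
    have "summable (\<lambda>k. L \<epsilon> ((Q \<epsilon> ^^ k) (w \<epsilon>)))"
      using neumann_series[OF elim(1) L_bounded_linear[OF elim(1)]] by (rule sums_summable)
    hence "1 - (\<Sum>k. L \<epsilon> ((Q \<epsilon> ^^ k) (w \<epsilon>)) / \<Delta> \<epsilon>) = \<nu> \<epsilon> (\<phi> 0) * (lam 0 - lam \<epsilon>) / \<Delta> \<epsilon>"
      using elim(2) by (simp add: suminf_divide \<nu>_gap_eq[OF elim(1)] diff_divide_distrib)
    thus ?case using elim(3) by simp
  qed
  ultimately show "((\<lambda>\<epsilon>. (lam 0 - lam \<epsilon>) / \<Delta> \<epsilon>)
           \<longlongrightarrow> 1 - (\<Sum>k. inverse (lam 0) ^ (k + 1) * q k)) to_zero"
    by (simp add: filterlim_cong)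
qed

end

section \<open>The perturbation theorem\<close>

lemma SUP_ennreal_finite_bound:
  fixes g :: "'i \<Rightarrow> real"
  assumes "(SUP i\<in>I. ennreal (g i)) < \<infinity>" and "i \<in> I"
  shows "g i \<le> enn2real (SUP i\<in>I. ennreal (g i))"
proof -
  have "ennreal (g i) \<le> (SUP i\<in>I. ennreal (g i))"
    using assms(2) by (rule SUP_upper)
  also have "\<dots> = ennreal (enn2real (SUP i\<in>I. ennreal (g i)))"
    using assms(1) by simp
  finally show ?thesis by (simp add: ennreal_le_iff)
qed

theorem theorem2p1:
  fixes scl :: "'k::{real_normed_field,banach} \<Rightarrow> 'v::real_normed_vector \<Rightarrow> 'v"
    and E :: "real set"
    and P Q :: "real \<Rightarrow> 'v \<Rightarrow> 'v"
    and lam :: "real \<Rightarrow> 'k"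
    and \<phi> :: "real \<Rightarrow> 'v"
    and \<nu> :: "real \<Rightarrow> 'v \<Rightarrow> 'k"
  assumes V: "normed_space_over scl"
    and E: "closed E" "0 islimpt E"
    and P: "\<forall>\<epsilon>\<in>E. bounded_operator scl (P \<epsilon>)" "(SUP \<epsilon>\<in>E. ennreal (onorm (P \<epsilon>))) < \<infinity>"
    and lam: "\<forall>\<epsilon>\<in>E. lam \<epsilon> \<noteq> 0"
    and \<nu>: "\<forall>\<epsilon>\<in>E. \<nu> \<epsilon> \<in> dual scl"
    and Q: "\<forall>\<epsilon>\<in>E. Vector_Spaces.linear scl scl (Q \<epsilon>)"
    and A1: "\<forall>\<epsilon>\<in>E. \<forall>\<psi>. scl (inverse (lam \<epsilon>)) (P \<epsilon> \<psi>) = rank_one scl (\<phi> \<epsilon>) (\<nu> \<epsilon>) \<psi> + Q \<epsilon> \<psi>"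
    and A2: "\<forall>\<epsilon>\<in>E. P \<epsilon> (\<phi> \<epsilon>) = scl (lam \<epsilon>) (\<phi> \<epsilon>)"
            "\<forall>\<epsilon>\<in>E. \<forall>\<psi>. \<nu> \<epsilon> (P \<epsilon> \<psi>) = lam \<epsilon> * \<nu> \<epsilon> \<psi>"
            "\<forall>\<epsilon>\<in>E. Q \<epsilon> (\<phi> \<epsilon>) = 0"
            "\<forall>\<epsilon>\<in>E. \<forall>\<psi>. \<nu> \<epsilon> (Q \<epsilon> \<psi>) = 0"
    and A3: "(\<Sum>n. SUP \<epsilon>\<in>E. ennreal (onorm (Q \<epsilon> ^^ n))) < \<infinity>"
    and A4: "\<forall>\<epsilon>\<in>E. \<nu> 0 (\<phi> \<epsilon>) = 1" "(SUP \<epsilon>\<in>E. ennreal (norm (\<phi> \<epsilon>))) < \<infinity>"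
    and A5: "(pert_eta P \<nu> \<longlongrightarrow> 0) (at 0 within E)"
    and A6: "\<exists>C\<^sub>3>0. \<forall>\<epsilon>\<in>E. pert_eta P \<nu> \<epsilon> * norm (P 0 (\<phi> 0) - P \<epsilon> (\<phi> 0))
                            \<le> C\<^sub>3 * norm (pert_Delta P \<phi> \<nu> \<epsilon>)"
  shows "(\<exists>\<epsilon>\<^sub>0>0. \<forall>\<epsilon>\<in>E. \<bar>\<epsilon>\<bar> \<le> \<epsilon>\<^sub>0 \<longrightarrow> pert_Delta P \<phi> \<nu> \<epsilon> = 0 \<longrightarrow> lam \<epsilon> = lam 0)
    \<and> (\<forall>q. (\<forall>\<^sub>F \<epsilon> in at 0 within E. pert_Delta P \<phi> \<nu> \<epsilon> \<noteq> 0) \<longrightarrow>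
           (\<forall>k. ((\<lambda>\<epsilon>. pert_corr P \<phi> \<nu> k \<epsilon> / pert_Delta P \<phi> \<nu> \<epsilon>) \<longlongrightarrow> q k) (at 0 within E)) \<longrightarrow>
           summable (\<lambda>k. inverse (lam 0) ^ (k + 1) * q k) \<and>
           ((\<lambda>\<epsilon>. (lam 0 - lam \<epsilon>) / pert_Delta P \<phi> \<nu> \<epsilon>)
              \<longlongrightarrow> 1 - (\<Sum>k. inverse (lam 0) ^ (k + 1) * q k)) (at 0 within E))"
proof -
  interpret V: normed_space_over scl by (fact V)
  have zero: "0 \<in> E"
    using E closed_limpt by blast
  obtain C where C: "\<forall>\<epsilon>\<in>E. pert_eta P \<nu> \<epsilon> * norm (P 0 (\<phi> 0) - P \<epsilon> (\<phi> 0))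
                            \<le> C * norm (pert_Delta P \<phi> \<nu> \<epsilon>)"
    using A6 by blast
  define p where "p = enn2real (SUP \<epsilon>\<in>E. ennreal (onorm (P \<epsilon>)))"
  define f where "f = enn2real (SUP \<epsilon>\<in>E. ennreal (norm (\<phi> \<epsilon>)))"
  define B where "B = (\<lambda>n. SUP \<epsilon>\<in>E. ennreal (onorm (Q \<epsilon> ^^ n)))"
  define b where "b = (\<lambda>n. enn2real (B n))"
  have B: "B n < \<infinity>" for n
    using A3 unfolding B_def by (rule ennreal_suminf_lessD)
  have "(\<Sum>n. ennreal (b n)) = (\<Sum>n. B n)"
    using B by (simp add: b_def)
  hence b: "summable b"
    using A3 by (intro summable_suminf_not_top) (auto simp: b_def B_def)
  interpret eigenvalue_perturbation scl E P Q lam \<phi> \<nu> p f C b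
  proof (intro eigenvalue_perturbation.intro eigenvalue_perturbation_axioms.intro
      V.normed_space_over_axioms)
    fix \<epsilon> x n
    assume e: "\<epsilon> \<in> E"
    show "simple_eigenvalue scl (P \<epsilon>) (Q \<epsilon>) (lam \<epsilon>) (\<phi> \<epsilon>) (\<nu> \<epsilon>)"
    proof (intro simple_eigenvalue.intro simple_eigenvalue_axioms.intro
        V.normed_space_over_axioms)
      interpret \<nu>0: Vector_Spaces.linear scl "(*)" "\<nu> 0"
        using \<nu> zero by (simp add: dual_def)
      show "\<phi> \<epsilon> \<noteq> 0"
        using A4(1) e \<nu>0.zero by force
      show "bounded_operator scl (P \<epsilon>)" "lam \<epsilon> \<noteq> 0" "\<nu> \<epsilon> \<in> dual scl"
        "Vector_Spaces.linear scl scl (Q \<epsilon>)" "P \<epsilon> (\<phi> \<epsilon>) = scl (lam \<epsilon>) (\<phi> \<epsilon>)" "Q \<epsilon> (\<phi> \<epsilon>) = 0"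
        using e P(1) lam \<nu> Q A2 by blast+
      show "scl (inverse (lam \<epsilon>)) (P \<epsilon> y) = rank_one scl (\<phi> \<epsilon>) (\<nu> \<epsilon>) y + Q \<epsilon> y"
        "\<nu> \<epsilon> (P \<epsilon> y) = lam \<epsilon> * \<nu> \<epsilon> y" for y
        using e A1 A2 by blast+
    qed
    have "norm (P \<epsilon> x) \<le> onorm (P \<epsilon>) * norm x"
      using P(1) e by (intro onorm) (simp add: bounded_operator_def)
    also have "\<dots> \<le> p * norm x"
      unfolding p_def by (intro mult_right_mono SUP_ennreal_finite_bound P(2) e) auto
    finally show "norm (P \<epsilon> x) \<le> p * norm x" .
    show "norm (\<phi> \<epsilon>) \<le> f"
      unfolding f_def by (rule SUP_ennreal_finite_bound[OF A4(2) e])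
    show "onorm (Q \<epsilon> ^^ n) \<le> b n"
      unfolding b_def B_def by (rule SUP_ennreal_finite_bound[OF B[unfolded B_def] e])
    show "\<nu> 0 (\<phi> \<epsilon>) = 1"
      "pert_eta P \<nu> \<epsilon> * norm (P 0 (\<phi> 0) - P \<epsilon> (\<phi> 0)) \<le> C * norm (pert_Delta P \<phi> \<nu> \<epsilon>)"
      using A4(1) C e by blast+
  next
    show "0 \<le> b n" for n
      by (simp add: b_def)
  qed (fact zero E(2) b A5)+
  show ?thesis
    by (intro conjI allI impI gap_eq_0 gap_tendsto) (assumption | elim allE)+
qed

end
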